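(* For real $x\ge 2$ let $n'(x)$ be the positive integer with $\#(n'(x))\le x<\#(n'(x)+1)$, let $r'(x)=\frac{x-\#(n'(x))}{\#(n'(x)+1)-\#(n'(x))}$, and let $$y(x)=p_{n'(x)}\left(1+\left(\frac{p_{n'(x)+1}}{p_{n'(x)}}-1\right)r'(x)\right).$$ Let $f(x)=\prod_{i=1}^{n'(x)}\frac{p_i}{p_i-1}$ and $g^{\circ}(x)=e^{\gamma}\log(y(x))$, where $\gamma$ is Euler's constant. Then $\lim_{x\to\infty}f(x)/g^{\circ}(x)=1$.
   Context: $p_n$ denotes the $n$-th prime number; $\#(n)=\prod_{i=1}^{n}p_i$ is the $n$-th primorial; $\log$ is the natural logarithm. *)

theory Defs
  imports "HOL-Analysis.Analysis" "HOL-Computational_Algebra.Primes"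
begin

text \<open>
  Primes are indexed from 1, so the first prime is \<open>nth_prime 1 = 2\<close>; \<open>enumerate\<close> counts from 0.
  The value at index 0 is irrelevant.
\<close>
definition nth_prime :: "nat \<Rightarrow> nat" where
  "nth_prime n = enumerate {p. prime p} (n - 1)"

definition primorial :: "nat \<Rightarrow> nat" where
  "primorial n = (\<Prod>i=1..n. nth_prime i)"

text \<open>Well defined for \<open>x \<ge> 2\<close> by \<open>ex1_primorial_index\<close> below.\<close>
definition n_idx :: "real \<Rightarrow> nat" where
  "n_idx x = (THE n. n \<ge> 1 \<and> real (primorial n) \<le> x \<and> x < real (primorial (n + 1)))"

definition r_frac :: "real \<Rightarrow> real" where
  "r_frac x = (x - real (primorial (n_idx x))) /
          (real (primorial (n_idx x + 1)) - real (primorial (n_idx x)))"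

definition y_interp :: "real \<Rightarrow> real" where
  "y_interp x = real (nth_prime (n_idx x)) *
         (1 + (real (nth_prime (n_idx x + 1)) / real (nth_prime (n_idx x)) - 1) * r_frac x)"

definition f_prod :: "real \<Rightarrow> real" where
  "f_prod x = (\<Prod>i=1..n_idx x. real (nth_prime i) / (real (nth_prime i) - 1))"

definition g_circ :: "real \<Rightarrow> real" where
  "g_circ x = exp euler_mascheroni * ln (y_interp x)"

lemma prime_nth_prime: "prime (nth_prime n)"
  using enumerate_in_set[OF primes_infinite, of "n - 1"] by (simp add: nth_prime_def)

lemma nth_prime_1: "nth_prime 1 = 2"
  unfolding nth_prime_def
  by (auto simp: enumerate_0 intro!: Least_equality dest: prime_ge_2_nat)

lemma primorial_1: "primorial 1 = 2"
  using nth_prime_1 by (simp add: primorial_def)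

lemma primorial_pos: "primorial n > 0"
  unfolding primorial_def by (intro prod_pos ballI prime_gt_0_nat prime_nth_prime)

lemma primorial_Suc: "primorial (Suc n) = primorial n * nth_prime (Suc n)"
  by (simp add: primorial_def)

lemma strict_mono_primorial: "strict_mono primorial"
  unfolding strict_mono_Suc_iff
  using primorial_pos prime_gt_1_nat[OF prime_nth_prime] by (simp add: primorial_Suc)

lemma ex1_primorial_index:
  fixes x :: real
  assumes "x \<ge> 2"
  shows "\<exists>!n. n \<ge> 1 \<and> real (primorial n) \<le> x \<and> x < real (primorial (n + 1))"
proof -
  define A where "A = {n. real (primorial n) \<le> x}"
  have "n \<le> nat \<lfloor>x\<rfloor>" if "n \<in> A" for n
    using that strict_mono_imp_increasing[OF strict_mono_primorial, of n]
    by (simp add: A_def le_nat_floor)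
  then have fin: "finite A"
    by (meson finite_nat_set_iff_bounded_le)
  have one: "1 \<in> A"
    using assms primorial_1 by (simp add: A_def)
  have "Max A \<in> A"
    using fin one by (intro Max_in) auto
  moreover have "Max A \<ge> 1"
    using fin one by simp
  moreover have "Max A + 1 \<notin> A"
    using Max_ge[OF fin, of "Max A + 1"] by auto
  ultimately have ex: "Max A \<ge> 1 \<and> real (primorial (Max A)) \<le> x \<and> x < real (primorial (Max A + 1))"
    by (simp add: A_def)
  have le: "m \<le> n" if "real (primorial m) \<le> x" "x < real (primorial (n + 1))" for m n
  proof -
    have "primorial m < primorial (n + 1)"
      using that by linarith
    then show ?thesis
      using strict_mono_less[OF strict_mono_primorial] by simp
  qed
  show ?thesis
    using ex le by (intro ex1I[of _ "Max A"]) (auto intro: antisym)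
qed

end

theory Submission
  imports Defs "HOL-Number_Theory.Number_Theory" "HOL-Real_Asymp.Real_Asymp"
begin

text \<open>
  With \<open>n = n_idx x\<close>, the value \<open>y_interp x\<close> lies between the \<open>n\<close>-th and the \<open>(n + 1)\<close>-st prime, so
  the claim is Mertens' third theorem
  \<open>(\<Prod>p | prime p \<and> p \<le> N. p / (p - 1)) \<sim> exp euler_mascheroni * ln N\<close>, used at both primes.

  The logarithm of the product is the sum of \<open>mangoldt n / (n * ln n)\<close> over \<open>n \<le> N\<close>, up to \<open>o(1)\<close>.
  Chebyshev's bound gives Mertens' first theorem, and Dirichlet's test turns that into convergence
  of this sum minus \<open>ln (ln N)\<close>. The limit is identified by Abel's theorem: the weights smoothed by
  \<open>n powr -\<delta>\<close> sum to the logarithm of the zeta function at \<open>1 + \<delta>\<close>, which is \<open>ln (1 / \<delta>) + o(1)\<close>,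
  and so does the harmonic series smoothed by \<open>exp (-\<delta>)\<close>.
\<close>

section \<open>Mertens' first theorem\<close>

text \<open>Passing from \<open>N\<close> to \<open>N + 1\<close> adds \<open>ln (N + 1)\<close>,
  which is the sum of \<open>mangoldt\<close> over the divisors of \<open>N + 1\<close>. These are
  exactly the \<open>d\<close> at which \<open>N div d\<close> jumps by one.\<close>

lemma ln_fact_eq_sum_mangoldt:
  "ln (fact N :: real) = (\<Sum>d=1..N. mangoldt d * real (N div d))"
proof (induction N)
  case (Suc N)
  have "ln (fact (Suc N) :: real) = ln (real (Suc N)) + ln (fact N :: real)"
    by (simp only: fact_Suc) (subst ln_mult; simp)
  also have "ln (real (Suc N)) = (\<Sum>d | d dvd Suc N. mangoldt d :: real)"
    by (subst mangoldt_sum) auto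
  also have "\<dots> = (\<Sum>d=1..Suc N. if d dvd Suc N then mangoldt d else 0)"
    by (subst sum.inter_filter [symmetric])
       (auto intro!: sum.cong dest: dvd_imp_le simp: Suc_le_eq intro: Nat.gr0I)
  also have "ln (fact N :: real) = (\<Sum>d=1..Suc N. mangoldt d * real (N div d))"
    using Suc.IH by simp
  also have "(\<Sum>d=1..Suc N. if d dvd Suc N then mangoldt d else 0) + \<dots> =
      (\<Sum>d=1..Suc N. mangoldt d * real (Suc N div d))"
    unfolding sum.distrib [symmetric]
    by (intro sum.cong) (auto simp: div_Suc dvd_eq_mod_eq_0 algebra_simps)
  finally show ?case .
qed auto

section \<open>Chebyshev's upper bound\<close>

definition psi :: "nat \<Rightarrow> real" where
  "psi N = (\<Sum>d=1..N. mangoldt d)"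

text \<open>Weighting \<open>mangoldt d\<close> by \<open>2 * n div d - 2 * (n div d)\<close> gives
  the logarithm of the central binomial coefficient, which is at most \<open>2 * n * ln 2\<close>.
  This factor is never negative and is at least 1 for \<open>n < d \<le> 2 * n\<close>.\<close>

lemma psi_double_le: "psi (2 * n) \<le> psi n + 2 * real n * ln 2"
proof -
  have "psi (2 * n) - psi n = (\<Sum>d\<in>{n<..2*n}. mangoldt d)"
  proof -
    have "{1..2*n} = {1..n} \<union> {n<..2*n}" by auto
    then have "psi (2 * n) = psi n + (\<Sum>d\<in>{n<..2*n}. mangoldt d)"
      unfolding psi_def by (metis (no_types) sum.union_disjoint finite_atLeastAtMost finite_greaterThanAtMost
        Int_emptyI atLeastAtMost_iff greaterThanAtMost_iff not_le)
    then show ?thesis by simp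
  qed
  also have "\<dots> \<le> (\<Sum>d\<in>{n<..2*n}. mangoldt d * (real (2 * n div d) - 2 * real (n div d)))"
  proof (intro sum_mono)
    fix d assume d: "d \<in> {n<..2*n}"
    then have "n div d = 0" "2 * n div d \<ge> 1"
      by (auto simp: Suc_le_eq div_greater_zero_iff)
    then show "mangoldt d \<le> mangoldt d * (real (2 * n div d) - 2 * real (n div d))"
      using mangoldt_nonneg[of d] by (simp add: mult_le_cancel_left1)
  qed
  also have "\<dots> \<le> (\<Sum>d=1..2*n. mangoldt d * (real (2 * n div d) - 2 * real (n div d)))"
  proof (intro sum_mono2 mult_nonneg_nonneg mangoldt_nonneg)
    fix d
    have "2 * (n div d) \<le> 2 * n div d"
      by (cases "d = 0") (auto simp: less_eq_div_iff_mult_less_eq)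
    then show "0 \<le> real (2 * n div d) - 2 * real (n div d)" by linarith
  qed auto
  also have "\<dots> = ln (fact (2 * n)) - 2 * (\<Sum>d=1..2*n. mangoldt d * real (n div d))"
    unfolding ln_fact_eq_sum_mangoldt
    by (simp add: algebra_simps sum_subtractf sum_distrib_left)
  also have "(\<Sum>d=1..2*n. mangoldt d * real (n div d)) = (\<Sum>d=1..n. mangoldt d * real (n div d))"
    by (intro sum.mono_neutral_right) auto
  also have "\<dots> = ln (fact n)" by (simp add: ln_fact_eq_sum_mangoldt)
  also have "ln (fact (2 * n)) - 2 * ln (fact n :: real) = ln (real (2 * n choose n))"
  proof -
    have "real (2 * n choose n) = fact (2 * n) / (fact n * fact n)"
      by (subst binomial_fact) (auto simp: mult_2)
    also have "ln \<dots> = ln (fact (2 * n)) - 2 * ln (fact n :: real)"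
      by (simp add: ln_div ln_mult)
    finally show ?thesis ..
  qed
  also have "\<dots> \<le> ln (2 ^ (2 * n))"
  proof -
    have "(2 * n choose n) \<le> 2 ^ (2 * n)"
      by (rule binomial_le_pow2)
    then have "real (2 * n choose n) \<le> 2 ^ (2 * n)"
      by (metis of_nat_le_iff of_nat_numeral of_nat_power)
    then show ?thesis by (subst ln_le_cancel_iff) (auto simp: zero_less_binomial_iff)
  qed
  also have "\<dots> = 2 * real n * ln 2" by (simp add: ln_realpow)
  finally show ?thesis by simp
qed

text \<open>Induction by halving, with the crude bound \<open>ln 2 < 1\<close>. The hypothesis gives
  \<open>4 * n\<close>, doubling costs \<open>2 * n\<close>, and an odd \<open>N\<close> costs at
  most another \<open>2 * n\<close> for its last term, in total the allowed
  \<open>8 * n\<close>.\<close>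

lemma psi_le: "psi N \<le> 4 * real N"
proof (induction N rule: less_induct)
  case (less N)
  consider "N = 0" | n where "N = 2 * n" "n > 0" | n where "N = Suc (2 * n)"
    by (metis evenE oddE gr0I mult_0_right Suc_eq_plus1)
  then show ?case
  proof cases
    case 2
    have "psi N \<le> 4 * real n + 2 * real n * ln 2"
      using psi_double_le[of n] less.IH[of n] 2 by simp
    also have "2 * real n * ln 2 \<le> 2 * real n * 1"
      using ln_2_less_1 by (intro mult_left_mono) auto
    finally show ?thesis using 2 by simp
  next
    case 3
    have "psi N = psi (2 * n) + mangoldt N"
      using 3 by (simp add: psi_def)
    also have "mangoldt N \<le> ln (real N)"
      using 3 by (intro mangoldt_le) auto
    also have "ln (real N) \<le> 2 * real n"
      using 3 ln_add_one_self_le_self[of "2 * real n"] by simp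
    also have "psi (2 * n) \<le> 4 * real n + 2 * real n * ln 2"
      using psi_double_le[of n] less.IH[of n] 3 by simp
    also have "2 * real n * ln 2 \<le> 2 * real n * 1"
      using ln_2_less_1 by (intro mult_left_mono) auto
    finally show ?thesis using 3 by simp
  qed (simp add: psi_def)
qed

lemma ln_fact_ge: "real N * ln (real N) - real N \<le> ln (fact N)"
proof (induction N)
  case (Suc N)
  have *: "real N * (ln (real (Suc N)) - ln (real N)) \<le> 1"
  proof (cases "N = 0")
    case False
    have "ln (real (Suc N)) - ln (real N) = ln (1 + 1 / real N)"
    proof -
      have "1 + 1 / real N = real (Suc N) / real N" using False by (simp add: field_simps)
      then show ?thesis using False by (simp only: ln_div) simp
    qed
    also have "\<dots> \<le> 1 / real N" by (rule ln_add_one_self_le_self) simp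
    finally show ?thesis using False by (simp add: field_simps)
  qed auto
  have "ln (fact (Suc N) :: real) = ln (real (Suc N)) + ln (fact N :: real)"
    by (simp only: fact_Suc) (subst ln_mult; simp)
  with Suc * show ?case by (simp add: algebra_simps)
qed auto

lemma ln_fact_le: "ln (fact N :: real) \<le> real N * ln (real N)"
proof -
  have "(fact N :: real) \<le> real N ^ N"
    using fact_le_power[of N, where ?'a = real] by simp
  then have "ln (fact N :: real) \<le> ln (real N ^ N)"
    by (cases "N = 0") (auto intro!: ln_mono)
  then show ?thesis by (cases "N = 0") (auto simp: ln_realpow)
qed

text \<open>Dropping the floor in \<open>N div d\<close> changes \<open>ln (fact N)\<close> by at
  most \<open>psi N\<close>; then divide by \<open>N\<close>. Chebyshev's bound costs 4 from above,
  Stirling's inequality \<open>ln_fact_ge\<close> costs 1 from below.\<close>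

lemma mertens_first:
  assumes "N > 0"
  shows "\<bar>(\<Sum>d=1..N. mangoldt d / real d) - ln (real N)\<bar> \<le> 4"
proof -
  define M where "M = (\<Sum>d=1..N. mangoldt d / real d :: real)"
  have eq: "real N * M = (\<Sum>d=1..N. mangoldt d * (real N / real d))"
    by (simp add: M_def sum_distrib_left mult_ac)
  have "ln (fact N) \<le> real N * M"
    unfolding eq ln_fact_eq_sum_mangoldt
    by (intro sum_mono mult_left_mono mangoldt_nonneg of_nat_div_le_of_nat)
  then have "real N * (ln (real N) - 1) \<le> real N * M"
    using ln_fact_ge[of N] by (simp add: algebra_simps)
  then have lower: "ln (real N) - 1 \<le> M" using assms by simp
  have "real N * M - psi N \<le> ln (fact N)"
    unfolding eq ln_fact_eq_sum_mangoldt psi_def sum_subtractf [symmetric]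
  proof (intro sum_mono)
    fix d
    have "real N / real d - 1 \<le> real (N div d)"
      using floor_divide_of_nat_eq[of N d, where ?'a = real] by linarith
    from mult_left_mono[OF this mangoldt_nonneg[of d]]
    show "mangoldt d * (real N / real d) - mangoldt d \<le> mangoldt d * real (N div d)"
      by (simp add: algebra_simps)
  qed
  then have "real N * M \<le> real N * (ln (real N) + 4)"
    using psi_le[of N] ln_fact_le[of N] by (simp add: algebra_simps)
  then have "M \<le> ln (real N) + 4" using assms by simp
  with lower show ?thesis unfolding M_def by linarith
qed

section \<open>Dirichlet's test and Abel's limit theorem\<close>

text \<open>Summation by parts moves the differences onto \<open>v\<close>. They telescope and have
  constant sign, so boundedness of the partial sums of \<open>c\<close> suffices for
  domination.\<close>

lemma summable_Dirichlet_test: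
  fixes c v :: "nat \<Rightarrow> real"
  assumes "decseq v" "v \<longlonglongrightarrow> 0" and bound: "\<And>n. \<bar>\<Sum>i<n. c i\<bar> \<le> B"
  shows "summable (\<lambda>n. c n * v n)"
proof -
  define C where "C = (\<lambda>n. \<Sum>i<n. c i)"
  \<comment> \<open>\<open>C (Suc i)\<close> is the partial sum that includes index
    \<open>i\<close>; the boundary term at 0 is absent since \<open>C 0 = 0\<close>.\<close>
  have eq: "(\<Sum>i<n. c i * v i) = C n * v n + (\<Sum>i<n. C (Suc i) * (v i - v (Suc i)))" for n
    by (induction n) (simp_all add: C_def algebra_simps)
  have "summable (\<lambda>i. C (Suc i) * (v i - v (Suc i)))"
  proof (rule summable_comparison_test)
    show "\<exists>N. \<forall>i\<ge>N. norm (C (Suc i) * (v i - v (Suc i))) \<le> B * (v i - v (Suc i))"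
      using bound \<open>decseq v\<close>
      by (auto simp: C_def abs_mult decseq_Suc_iff intro!: mult_right_mono simp del: sum.lessThan_Suc)
    show "summable (\<lambda>i. B * (v i - v (Suc i)))"
      using telescope_summable'[OF \<open>v \<longlonglongrightarrow> 0\<close>] by (intro summable_mult)
  qed
  then have "convergent (\<lambda>n. \<Sum>i<n. C (Suc i) * (v i - v (Suc i)))"
    by (simp add: summable_iff_convergent)
  moreover have "(\<lambda>n. C n * v n) \<longlonglongrightarrow> 0"
  proof (rule Lim_null_comparison)
    show "\<forall>\<^sub>F n in sequentially. norm (C n * v n) \<le> B * \<bar>v n\<bar>"
      using bound by (intro always_eventually) (auto simp: C_def abs_mult intro!: mult_right_mono)
    show "(\<lambda>n. B * \<bar>v n\<bar>) \<longlonglongrightarrow> 0"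
      using \<open>v \<longlonglongrightarrow> 0\<close> by (intro tendsto_mult_right_zero tendsto_rabs_zero)
  qed
  ultimately show ?thesis
    unfolding summable_iff_convergent eq by (intro convergent_add) (auto simp: convergent_def)
qed

section \<open>Growth of the weighted prime power sums\<close>

text \<open>Integral comparison with antiderivative \<open>ln (ln (x + 2))\<close>. The shift by 2
  avoids the singularity at 1, so that the integrand is antitone on the whole half-line.\<close>

lemma convergent_sum_inverse_n_ln_n:
  "convergent (\<lambda>N. (\<Sum>k\<le>N. 1 / ((real k + 2) * ln (real k + 2))) - ln (ln (real N + 2)))"
proof -
  define f where "f = (\<lambda>x::real. 1 / ((x + 2) * ln (x + 2)))"
  interpret antimono_fun_sum_integral_diff f
  proof
    show "f y \<le> f x" if "0 \<le> x" "x \<le> y" for x y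
      unfolding f_def using that
      by (intro divide_left_mono mult_mono mult_pos_pos) auto
    show "f x \<ge> 0" if "x \<ge> 0" for x
      unfolding f_def using that by auto
    show "continuous_on {0..} f"
      unfolding f_def by (intro continuous_intros) auto
  qed
  have "integral {0..real n} f = ln (ln (real n + 2)) - ln (ln 2)" for n
  proof -
    have "(f has_integral (ln (ln (real n + 2)) - ln (ln (0 + 2)))) {0..real n}"
    proof (rule fundamental_theorem_of_calculus)
      fix x assume x: "x \<in> {0..real n}"
      have "((\<lambda>x. ln (ln (x + 2))) has_real_derivative f x) (at x within {0..real n})"
        unfolding f_def using x
        by (auto intro!: derivative_eq_intros simp: divide_simps)
      then show "((\<lambda>x. ln (ln (x + 2))) has_vector_derivative f x) (at x within {0..real n})"
        by (simp add: has_real_derivative_iff_has_vector_derivative)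
    qed simp
    then show ?thesis by (simp add: integral_unique)
  qed
  then have "sum_integral_diff_series =
      (\<lambda>N. (\<Sum>k\<le>N. 1 / ((real k + 2) * ln (real k + 2))) - ln (ln (real N + 2)) + ln (ln 2))"
    unfolding sum_integral_diff_series_def fun_eq_iff by (simp add: f_def)
  with sum_integral_diff_series_convergent show ?thesis
    by (simp add: convergent_add_const_right_iff)
qed

text \<open>At a prime power \<open>p ^ k\<close> this is \<open>1 / (k * p ^ k)\<close>: the terms
  of the Dirichlet series of the logarithm of zeta, taken at 1. Division by zero makes the values at
  0 and 1 vanish.\<close>

definition mangoldt_weight :: "nat \<Rightarrow> real" where
  "mangoldt_weight n = mangoldt n / (real n * ln (real n))"

lemma mangoldt_weight_nonneg: "mangoldt_weight n \<ge> 0"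
  by (cases "n = 0")
     (auto simp: mangoldt_weight_def intro!: divide_nonneg_nonneg mangoldt_nonneg mult_nonneg_nonneg)

lemma mangoldt_weight_1 [simp]: "mangoldt_weight (Suc 0) = 0"
  by (simp add: mangoldt_weight_def)

text \<open>Split \<open>mangoldt n\<close> into \<open>mangoldt n - 1\<close> and 1. Mertens' first
  theorem and the harmonic numbers bound the partial sums of \<open>(mangoldt n - 1) / n\<close>, so
  Dirichlet's test with \<open>1 / ln n\<close> applies; the constant part is the integral
  comparison above.\<close>

lemma convergent_sum_mangoldt_weight:
  "convergent (\<lambda>N. (\<Sum>n=1..N. mangoldt_weight n) - ln (ln (real N)))"
proof -
  define c where "c = (\<lambda>k. (mangoldt (k + 2) - 1) / (real k + 2) :: real)"
  define v where "v = (\<lambda>k. 1 / ln (real k + 2))"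
  have shift: "(\<Sum>k<N. g (k + 2)) = (\<Sum>n=1..Suc N. g n) - g 1" for g :: "nat \<Rightarrow> real" and N
    by (induction N) auto
  have "Bseq (\<lambda>n. harm n - ln (real n) :: real)"
    using euler_mascheroni_convergent by (rule convergent_imp_Bseq)
  then obtain K where K: "\<And>n. \<bar>harm n - ln (real n) :: real\<bar> \<le> K"
    unfolding Bseq_def by auto
  \<comment> \<open>4 comes from \<open>mertens_first\<close>, \<open>K\<close> from the harmonic
    numbers, and 1 from the harmonic term at index 1, which the shifted sum omits.\<close>
  have "\<bar>\<Sum>i<n. c i\<bar> \<le> 5 + K" for n
  proof -
    have "(\<Sum>i<n. c i) = (\<Sum>i<n. mangoldt (i + 2) / real (i + 2)) - (\<Sum>i<n. 1 / real (i + 2))"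
      by (simp add: c_def diff_divide_distrib sum_subtractf add.commute)
    also have "\<dots> = (\<Sum>d=1..Suc n. mangoldt d / real d) - harm (Suc n) + 1"
      by (subst (1 2) shift) (simp add: harm_def inverse_eq_divide)
    finally show ?thesis
      using mertens_first[of "Suc n"] K[of "Suc n"] by linarith
  qed
  moreover have "decseq v"
    unfolding v_def decseq_def by (auto intro!: divide_left_mono mult_pos_pos)
  moreover have "v \<longlonglongrightarrow> 0"
    unfolding v_def by real_asymp
  ultimately have "summable (\<lambda>k. c k * v k)"
    by (intro summable_Dirichlet_test)
  then have "convergent (\<lambda>N. \<Sum>k\<le>N. c k * v k)"
    by (simp add: summable_iff_convergent')
  then have "convergent (\<lambda>N. (\<Sum>k\<le>N. c k * v k) +
      ((\<Sum>k\<le>N. 1 / ((real k + 2) * ln (real k + 2))) - ln (ln (real N + 2))))"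
    by (intro convergent_add convergent_sum_inverse_n_ln_n)
  moreover have "(\<Sum>k\<le>N. c k * v k) + ((\<Sum>k\<le>N. 1 / ((real k + 2) * ln (real k + 2))) - ln (ln (real N + 2)))
      = (\<Sum>n=1..N+2. mangoldt_weight n) - ln (ln (real (N + 2)))" for N
  proof -
    have "(\<Sum>k\<le>N. c k * v k) + (\<Sum>k\<le>N. 1 / ((real k + 2) * ln (real k + 2))) =
        (\<Sum>k<Suc N. mangoldt_weight (k + 2))"
      unfolding sum.distrib [symmetric] lessThan_Suc_atMost
      by (intro sum.cong) (auto simp: c_def v_def mangoldt_weight_def add_divide_distrib [symmetric] add_ac)
    also have "\<dots> = (\<Sum>n=1..N+2. mangoldt_weight n)"
      by (subst shift) simp
    finally show ?thesis by (simp add: add.commute)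
  qed
  ultimately have "convergent (\<lambda>N. (\<Sum>n=1..N+2. mangoldt_weight n) - ln (ln (real (N + 2))))"
    by simp
  then show ?thesis
    by (rule convergent_ignore_initial_segment [THEN iffD1])
qed

section \<open>Abel's limit theorem\<close>

text \<open>The weights \<open>(1 - r) * r ^ n\<close> have total mass 1, and the mass of any fixed
  initial segment vanishes as \<open>r\<close> tends to 1.\<close>

lemma abel_mean_null:
  fixes e :: "nat \<Rightarrow> real"
  assumes "e \<longlonglongrightarrow> 0"
  shows "((\<lambda>r. (1 - r) * (\<Sum>n. e n * r ^ n)) \<longlongrightarrow> 0) (at_left 1)"
proof (rule tendstoI)
  fix \<epsilon> :: real assume \<epsilon>: "\<epsilon> > 0"
  obtain K where K: "\<And>n. n \<ge> K \<Longrightarrow> \<bar>e n\<bar> < \<epsilon> / 2"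
    using LIMSEQ_D[OF assms, of "\<epsilon> / 2"] \<epsilon> by auto
  define B where "B = (\<Sum>n<K. \<bar>e n\<bar>)"
  have "((\<lambda>r. (1 - r) * B) \<longlongrightarrow> (1 - 1) * B) (at_left 1)"
    by (intro tendsto_intros)
  then have "\<forall>\<^sub>F r in at_left 1. (1 - r) * B < \<epsilon> / 2"
    using \<epsilon> by (intro order_tendstoD(2)) auto
  moreover have "\<forall>\<^sub>F r in at_left (1::real). r \<in> {0<..<1}"
    using eventually_at_left_real[of 0 "1::real"] by simp
  ultimately show "\<forall>\<^sub>F r in at_left 1. dist ((1 - r) * (\<Sum>n. e n * r ^ n)) 0 < \<epsilon>"
  proof eventually_elim
    case (elim r)
    \<comment> \<open>The geometric part of the majorant is kept for all \<open>n\<close>, also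
      below \<open>K\<close>, so that its sum is explicit.\<close>
    define w where "w = (\<lambda>n. (if n < K then \<bar>e n\<bar> else 0) + \<epsilon> / 2 * r ^ n)"
    have w: "w sums (B + \<epsilon> / 2 * (1 / (1 - r)))"
      unfolding w_def B_def using elim
      by (intro sums_add sums_mult geometric_sums sums_If_finite_set[of "{..<K}", simplified]) auto
    have le: "norm (e n * r ^ n) \<le> w n" for n
    proof (cases "n < K")
      case True
      have "\<bar>e n\<bar> * r ^ n \<le> \<bar>e n\<bar> * 1"
        using elim by (intro mult_left_mono power_le_one) auto
      moreover have "\<epsilon> / 2 * r ^ n \<ge> 0" using \<epsilon> elim by auto
      ultimately show ?thesis using True elim by (simp add: w_def abs_mult)
    next
      case False
      have "\<bar>e n\<bar> * r ^ n \<le> \<epsilon> / 2 * r ^ n"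
        using elim False K[of n] by (intro mult_right_mono) auto
      then show ?thesis using False elim by (simp add: w_def abs_mult)
    qed
    have "norm (\<Sum>n. e n * r ^ n) \<le> suminf w"
      using le w by (intro norm_suminf_le) (auto simp: sums_iff)
    also have "\<dots> = B + \<epsilon> / 2 * (1 / (1 - r))"
      using w by (simp add: sums_iff)
    finally have "(1 - r) * \<bar>\<Sum>n. e n * r ^ n\<bar> \<le> (1 - r) * (B + \<epsilon> / 2 * (1 / (1 - r)))"
      using elim by (intro mult_left_mono) auto
    also have "\<dots> = (1 - r) * B + \<epsilon> / 2"
      using elim by (simp add: field_simps)
    finally show ?case
      using elim by (simp add: abs_mult)
  qed
qed

text \<open>Summation by parts turns the deviation from \<open>L\<close> into an Abel mean of the
  errors \<open>e\<close> of the partial sums.\<close>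

lemma abel_limit_theorem:
  fixes d :: "nat \<Rightarrow> real"
  assumes "d sums L"
  shows "((\<lambda>r. \<Sum>n. d n * r ^ n) \<longlongrightarrow> L) (at_left 1)"
proof -
  define e where "e = (\<lambda>n. (\<Sum>i\<le>n. d i) - L)"
  have e: "e \<longlonglongrightarrow> 0"
    using assms unfolding e_def sums_def_le by (simp add: LIM_zero)
  have "Bseq e" using e by (intro convergent_imp_Bseq) (auto simp: convergent_def)
  then obtain K where K: "\<And>n. \<bar>e n\<bar> \<le> K" unfolding Bseq_def by auto
  have "(\<Sum>n. d n * r ^ n) = L + (1 - r) * (\<Sum>n. e n * r ^ n)" if r: "0 < r" "r < 1" for r
  proof -
    have sum_e: "summable (\<lambda>n. e n * r ^ n)"
    proof (rule summable_comparison_test)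
      show "\<exists>N. \<forall>n\<ge>N. norm (e n * r ^ n) \<le> K * r ^ n"
        using K r by (auto simp: abs_mult intro!: mult_right_mono)
      show "summable (\<lambda>n. K * r ^ n)" using r by (intro summable_mult summable_geometric) auto
    qed
    \<comment> \<open>Subtracting \<open>r\<close> times the series of \<open>e\<close> from its
      shift leaves the coefficients \<open>e (Suc n) - e n = d (Suc n)\<close>.\<close>
    have "(\<lambda>n. e (Suc n) * r ^ Suc n) sums ((\<Sum>n. e n * r ^ n) - e 0 * r ^ 0)"
      using sum_e by (subst sums_Suc_iff) (simp add: summable_sums)
    from sums_diff[OF this sums_mult[OF summable_sums[OF sum_e], of r]]
    have "(\<lambda>n. d (Suc n) * r ^ Suc n) sums ((\<Sum>n. e n * r ^ n) - e 0 - r * (\<Sum>n. e n * r ^ n))"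
      by (simp add: e_def algebra_simps)
    then have "(\<lambda>n. d n * r ^ n) sums ((\<Sum>n. e n * r ^ n) - e 0 - r * (\<Sum>n. e n * r ^ n) + d 0 * r ^ 0)"
      by (subst (asm) sums_Suc_iff) simp
    then show ?thesis by (simp add: sums_iff e_def algebra_simps)
  qed
  then have "\<forall>\<^sub>F r in at_left 1. L + (1 - r) * (\<Sum>n. e n * r ^ n) = (\<Sum>n. d n * r ^ n)"
    using eventually_at_left_real[of 0 "1::real"] by (auto elim!: eventually_mono)
  moreover have "((\<lambda>r. L + (1 - r) * (\<Sum>n. e n * r ^ n)) \<longlongrightarrow> L + 0) (at_left 1)"
    by (intro tendsto_intros abel_mean_null e)
  ultimately show ?thesis
    by (simp add: tendsto_cong)
qed

section \<open>Truncated Euler products\<close>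

text \<open>Adjoining a prime \<open>p\<close> multiplies by a geometric series: each admissible
  number is uniquely \<open>m * p ^ k\<close> with \<open>m\<close> composed of the old primes. The
  unordered \<open>has_sum\<close> allows reindexing along this bijection.\<close>

lemma has_sum_euler_product_finite:
  fixes s :: real
  assumes "finite P" "\<And>p. p \<in> P \<Longrightarrow> prime p" "s > 0"
  shows "((\<lambda>n. real n powr -s) has_sum (\<Prod>p\<in>P. 1 / (1 - real p powr -s)))
           {n. n > 0 \<and> prime_factors n \<subseteq> P}"
  using assms(1,2)
proof (induction P)
  case empty
  have "{n::nat. n > 0 \<and> prime_factors n \<subseteq> {}} = {1}"
    by (auto simp: prime_factorization_empty_iff)
  then show ?case by (simp add: has_sum_finite_iff)
next
  case (insert p P)
  define A where "A = {n::nat. n > 0 \<and> prime_factors n \<subseteq> P}"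
  define x where "x = real p powr -s"
  define Q where "Q = (\<Prod>p\<in>P. 1 / (1 - real p powr -s))"
  have p: "prime p" using insert.prems by auto
  have x: "0 < x" "x < 1"
    using prime_gt_1_nat[OF p] \<open>s > 0\<close> by (auto simp: x_def powr_less_one)
  have IH: "((\<lambda>n. real n powr -s) has_sum Q) A"
    unfolding A_def Q_def using insert by auto
  define f where "f = (\<lambda>(n::nat, k::nat). real n powr -s * x ^ k)"
  have geo: "((\<lambda>k. x ^ k) has_sum (1 / (1 - x))) UNIV"
    using x by (intro norm_summable_imp_has_sum) (auto intro: geometric_sums)
  have inner: "((\<lambda>k. f (n, k)) has_sum (real n powr -s * (1 / (1 - x)))) UNIV" for n
    using has_sum_cmult_right[OF geo, of "real n powr -s"] by (simp add: f_def)
  have outer: "((\<lambda>n. real n powr -s * (1 / (1 - x))) has_sum (Q * (1 / (1 - x)))) A"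
    by (intro has_sum_cmult_left IH)
  have "(f has_sum (Q * (1 / (1 - x)))) (A \<times> UNIV)"
  proof (rule has_sum_SigmaI[OF inner outer])
    show "f summable_on A \<times> UNIV"
      by (rule summable_on_SigmaI[OF inner has_sum_imp_summable[OF outer]])
         (use x in \<open>auto simp: f_def\<close>)
  qed
  also have "(f has_sum (Q * (1 / (1 - x)))) (A \<times> UNIV) \<longleftrightarrow>
      ((\<lambda>n. real n powr -s) has_sum (\<Prod>p\<in>insert p P. 1 / (1 - real p powr -s)))
           {n. n > 0 \<and> prime_factors n \<subseteq> insert p P}"
  proof (rule has_sum_reindex_bij_witness[where j = "\<lambda>(n, k). n * p ^ k"
        and i = "\<lambda>n. (n div p ^ multiplicity p n, multiplicity p n)"])
    show "Q * (1 / (1 - x)) = (\<Prod>p\<in>insert p P. 1 / (1 - real p powr -s))"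
      using insert.hyps by (simp add: Q_def x_def)
  next
    fix a :: "nat \<times> nat" assume a: "a \<in> A \<times> UNIV"
    obtain n k where [simp]: "a = (n, k)" by force
    have n: "n > 0" "prime_factors n \<subseteq> P" using a by (auto simp: A_def)
    have "p \<notin> prime_factors n" using n insert.hyps by auto
    then have "\<not> p dvd n" using n p by (auto simp: in_prime_factors_iff)
    then have mult: "multiplicity p (n * p ^ k) = k"
      using n p by (simp add: prime_elem_multiplicity_mult_distrib not_dvd_imp_multiplicity_0)
    then show "(\<lambda>n. (n div p ^ multiplicity p n, multiplicity p n)) ((\<lambda>(n, k). n * p ^ k) a) = a"
      using p by (auto simp: prime_gt_0_nat)
    have "prime_factors (p ^ k) \<subseteq> {p}"
      using p by (cases "k = 0") (auto simp: prime_factors_power prime_factorization_prime)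
    then show "(\<lambda>(n, k). n * p ^ k) a \<in> {n. n > 0 \<and> prime_factors n \<subseteq> insert p P}"
      using n p by (auto simp: prime_factors_product prime_gt_0_nat)
    have "real (p ^ k) powr -s = x ^ k"
      using p by (simp add: x_def prime_gt_0_nat powr_realpow [symmetric] powr_powr powr_power mult.commute)
    then show "real ((\<lambda>(n, k). n * p ^ k) a) powr -s = f a"
      by (simp add: f_def powr_mult)
  next
    fix n :: nat assume n: "n \<in> {n. n > 0 \<and> prime_factors n \<subseteq> insert p P}"
    show eq: "(\<lambda>(n, k). n * p ^ k) (n div p ^ multiplicity p n, multiplicity p n) = n"
      by (simp add: multiplicity_dvd)
    define m where "m = n div p ^ multiplicity p n"
    have nm: "n = m * p ^ multiplicity p n" using eq by (simp add: m_def)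
    have "m > 0" using nm n by (auto intro: Nat.gr0I)
    moreover have "prime_factors m \<subseteq> insert p P"
      using n nm dvd_prime_factors[of n m] by (metis (mono_tags, lifting) dvd_triv_left mem_Collect_eq
          not_gr_zero order_trans)
    moreover have "\<not> p dvd m"
      unfolding m_def using n p by (intro multiplicity_decompose) auto
    ultimately show "(n div p ^ multiplicity p n, multiplicity p n) \<in> A \<times> UNIV"
      by (auto simp: A_def m_def [symmetric] in_prime_factors_iff)
  qed
  finally show ?case .
qed

text \<open>The mean value theorem places the increment of
  \<open>- (x powr -\<delta>) / \<delta>\<close> between consecutive terms of the series, and these
  increments telescope.\<close>

lemma sum_powr_telescope_bounds:
  fixes \<delta> :: real
  assumes "\<delta> > 0"
  shows "(\<Sum>n=1..N. real n powr -(1 + \<delta>)) \<le> 1 + 1 / \<delta>"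
    and "(1 - real (Suc N) powr -\<delta>) / \<delta> \<le> (\<Sum>n=1..N. real n powr -(1 + \<delta>))"
proof -
  have step: "real (Suc n) powr -(1 + \<delta>) \<le> (real n powr -\<delta> - real (Suc n) powr -\<delta>) / \<delta>"
       "(real n powr -\<delta> - real (Suc n) powr -\<delta>) / \<delta> \<le> real n powr -(1 + \<delta>)" if "n > 0" for n
  proof -
    have eq: "- 1 - \<delta> = - \<delta> - 1" by simp
    have "\<exists>z. real n < z \<and> z < real (Suc n) \<and>
        real (Suc n) powr -\<delta> - real n powr -\<delta> = (real (Suc n) - real n) * (-\<delta> * z powr -(1 + \<delta>))"
      using that by (intro MVT2) (auto intro!: derivative_eq_intros simp: eq)
    then obtain z where z: "real n < z" "z < real (Suc n)"
        "(real n powr -\<delta> - real (Suc n) powr -\<delta>) / \<delta> = z powr -(1 + \<delta>)"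
      using assms by (auto simp: field_simps)
    show "real (Suc n) powr -(1 + \<delta>) \<le> (real n powr -\<delta> - real (Suc n) powr -\<delta>) / \<delta>"
         "(real n powr -\<delta> - real (Suc n) powr -\<delta>) / \<delta> \<le> real n powr -(1 + \<delta>)"
      unfolding z(3) using z that assms by (auto intro!: powr_mono2')
  qed
  show "(1 - real (Suc N) powr -\<delta>) / \<delta> \<le> (\<Sum>n=1..N. real n powr -(1 + \<delta>))"
  proof (induction N)
    case (Suc N)
    then show ?case using step(2)[of "Suc N"] by (simp add: diff_divide_distrib)
  qed auto
  \<comment> \<open>The first estimate bounds the term at \<open>n + 1\<close> only for positive
    \<open>n\<close>, so the term at 1 stays apart as the summand 1.\<close>
  have "(\<Sum>n=1..Suc N. real n powr -(1 + \<delta>)) \<le> 1 + (1 - real (Suc N) powr -\<delta>) / \<delta>" for N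
  proof (induction N)
    case (Suc N)
    then show ?case using step(1)[of "Suc N"] by (simp add: diff_divide_distrib)
  qed auto
  also have "1 + (1 - real (Suc M) powr -\<delta>) / \<delta> \<le> 1 + 1 / \<delta>" for M
    using assms by (simp add: divide_right_mono)
  finally show "(\<Sum>n=1..N. real n powr -(1 + \<delta>)) \<le> 1 + 1 / \<delta>"
    using assms by (cases N) auto
qed

definition log_euler :: "nat \<Rightarrow> real \<Rightarrow> real" where
  "log_euler N s = (\<Sum>p | prime p \<and> p \<le> N. - ln (1 - real p powr -s))"

lemma prime_powr_less_1: "prime p \<Longrightarrow> s > 0 \<Longrightarrow> real p powr -s < 1"
  by (auto dest: prime_gt_1_nat simp: powr_less_one)

lemma exp_log_euler:
  assumes "s > 0"
  shows "exp (log_euler N s) = (\<Prod>p | prime p \<and> p \<le> N. 1 / (1 - real p powr -s))"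
  unfolding log_euler_def
  by (subst exp_sum)
     (use assms in \<open>auto intro!: prod.cong simp: exp_minus inverse_eq_divide prime_powr_less_1\<close>)

text \<open>The truncated Euler product is the sum over the numbers without prime factor above
  \<open>N\<close>. These include all of \<open>{1..N}\<close>, which gives the lower bound; every
  finite set of them lies in an initial segment, which gives an upper bound independent of
  \<open>N\<close>.\<close>

lemma log_euler_bounds:
  fixes \<delta> :: real
  assumes "\<delta> > 0" "N > 0"
  shows "log_euler N (1 + \<delta>) \<le> ln (1 + 1 / \<delta>)"
    and "ln ((1 - real (Suc N) powr -\<delta>) / \<delta>) \<le> log_euler N (1 + \<delta>)"
proof -
  define A where "A = {n. n > 0 \<and> prime_factors n \<subseteq> {p. prime p \<and> p \<le> N}}"
  have hs: "((\<lambda>n. real n powr -(1 + \<delta>)) has_sum exp (log_euler N (1 + \<delta>))) A"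
    unfolding A_def using assms
    by (subst exp_log_euler) (simp, intro has_sum_euler_product_finite, auto)
  have "exp (log_euler N (1 + \<delta>)) \<le> 1 + 1 / \<delta>"
  proof (rule has_sum_le_finite_sums[OF hs])
    fix F assume F: "finite F" "F \<subseteq> A"
    \<comment> \<open>Inserting 0 keeps \<open>Max\<close> meaningful for empty
      \<open>F\<close>.\<close>
    have "F \<subseteq> {1..Max (insert 0 F)}"
      using F by (auto simp: A_def Suc_le_eq)
    then have "(\<Sum>n\<in>F. real n powr -(1 + \<delta>)) \<le> (\<Sum>n=1..Max (insert 0 F). real n powr -(1 + \<delta>))"
      by (intro sum_mono2) auto
    also have "\<dots> \<le> 1 + 1 / \<delta>" by (rule sum_powr_telescope_bounds) fact
    finally show "(\<Sum>n\<in>F. real n powr -(1 + \<delta>)) \<le> 1 + 1 / \<delta>" .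
  qed
  then show "log_euler N (1 + \<delta>) \<le> ln (1 + 1 / \<delta>)"
    using assms by (subst ln_ge_iff) (auto intro: add_pos_pos)
  have "(1 - real (Suc N) powr -\<delta>) / \<delta> \<le> (\<Sum>n=1..N. real n powr -(1 + \<delta>))"
    by (rule sum_powr_telescope_bounds) fact
  also have "\<dots> \<le> exp (log_euler N (1 + \<delta>))"
  proof (rule has_sum_mono2[OF _ hs])
    show "((\<lambda>n. real n powr -(1 + \<delta>)) has_sum (\<Sum>n=1..N. real n powr -(1 + \<delta>))) {1..N}"
      by (intro has_sum_finite) auto
    show "{1..N} \<subseteq> A"
      by (auto simp: A_def in_prime_factors_iff intro: order.trans[OF dvd_imp_le])
  qed auto
  finally have le: "(1 - real (Suc N) powr -\<delta>) / \<delta> \<le> exp (log_euler N (1 + \<delta>))" .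
  have "real (Suc N) powr -\<delta> < 1"
    using assms by (intro powr_less_one) auto
  then show "ln ((1 - real (Suc N) powr -\<delta>) / \<delta>) \<le> log_euler N (1 + \<delta>)"
    using le assms ln_mono[OF le] by simp
qed

text \<open>The Dirichlet series of the logarithm of zeta at \<open>s\<close>, cut off at prime
  powers up to \<open>N\<close>, whereas \<open>log_euler\<close> keeps all powers of the primes up
  to \<open>N\<close>.\<close>

definition mangoldt_sum_powr :: "nat \<Rightarrow> real \<Rightarrow> real" where
  "mangoldt_sum_powr N s = (\<Sum>n=1..N. mangoldt_weight n * real n powr (1 - s))"

text \<open>Grouping prime powers by their prime allows a comparison with \<open>log_euler\<close>
  one Euler factor at a time.\<close>

lemma mangoldt_sum_powr_altdef:
  "mangoldt_sum_powr N s =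
     (\<Sum>p | prime p \<and> p \<le> N. \<Sum>k | k > 0 \<and> p ^ k \<le> N. (real p powr -s) ^ k / real k)"
proof -
  have fin: "finite {k. k > 0 \<and> p ^ k \<le> N}" if "prime p" for p
  proof (rule finite_subset)
    show "{k. k > 0 \<and> p ^ k \<le> N} \<subseteq> {..N}"
      using power_gt_expt[of p] prime_gt_1_nat[OF that] by (auto intro: less_imp_le order.trans)
  qed auto
  have "mangoldt_sum_powr N s = (\<Sum>n | primepow n \<and> n \<le> N. mangoldt_weight n * real n powr (1 - s))"
    unfolding mangoldt_sum_powr_def
    by (intro sum.mono_neutral_right)
       (auto simp: Suc_le_eq primepow_gt_0_nat mangoldt_weight_def mangoldt_def)
  also have "\<dots> = (\<Sum>(p,k)\<in>(SIGMA p:{p. prime p \<and> p \<le> N}. {k. k > 0 \<and> p ^ k \<le> N}).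
      (real p powr -s) ^ k / real k)"
  proof (rule sum.reindex_bij_witness[symmetric, where i = "\<lambda>n. (aprimedivisor n, multiplicity (aprimedivisor n) n)"
        and j = "\<lambda>(p, k). p ^ k"])
    fix a assume a: "a \<in> (SIGMA p:{p. prime p \<and> p \<le> N}. {k. k > 0 \<and> p ^ k \<le> N})"
    obtain p k where [simp]: "a = (p, k)" by force
    have p: "prime p" "k > 0" "p ^ k \<le> N" using a by auto
    have p1: "p > 1" using p prime_gt_1_nat by auto
    show "(\<lambda>n. (aprimedivisor n, multiplicity (aprimedivisor n) n)) ((\<lambda>(p, k). p ^ k) a) = a"
      using p by (simp add: aprimedivisor_prime_power)
    show "(\<lambda>(p, k). p ^ k) a \<in> {n. primepow n \<and> n \<le> N}" using p by simp
    have "real (p ^ k) powr (1 - s) = real p ^ k * (real p powr -s) ^ k"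
    proof -
      have "real (p ^ k) powr (1 - s) = real p powr (real k + (- s * real k))"
        using p1 by (simp add: powr_realpow [symmetric] powr_powr algebra_simps)
      also have "\<dots> = real p ^ k * (real p powr -s) ^ k"
        using p1 by (simp only: powr_add) (simp add: powr_realpow powr_power mult.commute)
      finally show ?thesis .
    qed
    then show "mangoldt_weight ((\<lambda>(p, k). p ^ k) a) * real ((\<lambda>(p, k). p ^ k) a) powr (1 - s) =
       (case a of (p, k) \<Rightarrow> (real p powr -s) ^ k / real k)"
      using p p1 by (simp add: mangoldt_weight_def ln_realpow)
  next
    fix n assume n: "n \<in> {n. primepow n \<and> n \<le> N}"
    then have "n > Suc 0" using primepow_gt_Suc_0 by auto
    then show "(aprimedivisor n, multiplicity (aprimedivisor n) n) \<in>
        (SIGMA p:{p. prime p \<and> p \<le> N}. {k. k > 0 \<and> p ^ k \<le> N})"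
      using n aprimedivisor_le_nat[of n] aprimedivisor_nat[of n] by (auto simp: primepow_decompose)
    show "(\<lambda>(p, k). p ^ k) (aprimedivisor n, multiplicity (aprimedivisor n) n) = n"
      using n by (auto simp: primepow_decompose)
  qed
  also have "\<dots> = (\<Sum>p | prime p \<and> p \<le> N. \<Sum>k | k > 0 \<and> p ^ k \<le> N. (real p powr -s) ^ k / real k)"
    using fin by (subst sum.Sigma) auto
  finally show ?thesis .
qed

text \<open>\<open>t\<close> is part of the nonnegative series of \<open>- ln (1 - x)\<close>. The
  missing powers satisfy \<open>p ^ k > N\<close>, hence \<open>k \<ge> 2\<close> as
  \<open>p \<le> N\<close>, and a geometric series bounds them uniformly in
  \<open>s\<close>.\<close>

lemma log_euler_factor_tail:
  assumes p: "prime p" "p \<le> N" and s: "s \<ge> 1"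
  defines "t \<equiv> (\<Sum>k | k > 0 \<and> p ^ k \<le> N. (real p powr -s) ^ k / real k)"
  shows "t \<le> - ln (1 - real p powr -s)"
    and "- ln (1 - real p powr -s) \<le>
           t + real N powr (-1/4) * (real p powr (-3/2) / (1 - 2 powr (-3/4)))"
proof -
  define x where "x = real p powr -s"
  define y where "y = real p powr (-3/4)"
  define K where "K = {k. k > 0 \<and> p ^ k \<le> N}"
  have p2: "p \<ge> 2" using p prime_ge_2_nat by auto
  have N: "N > 0" using p p2 by auto
  have finK: "finite K"
  proof (rule finite_subset)
    show "K \<subseteq> {..N}"
      using power_gt_expt[of p] p2 by (auto simp: K_def intro: less_imp_le order.trans)
  qed auto
  have x: "0 < x" "x < 1" using p s p2 by (auto simp: x_def prime_powr_less_1)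
  have y: "0 < y" "y < 1" "y \<le> 2 powr (-3/4)"
    using p2 by (auto simp: y_def powr_less_one intro!: powr_mono2')
  \<comment> \<open>The series starts at \<open>k = 0\<close>, where division by zero makes the term
    0.\<close>
  from sums_minus[OF Complex_Transcendental.ln_series'[of "-x"]]
  have "(\<lambda>k. x ^ k / real k) sums - ln (1 - x)" using x by simp
  moreover have "(\<lambda>k. if k \<in> K then x ^ k / real k else 0) sums t"
    unfolding t_def K_def [symmetric] x_def [symmetric] by (intro sums_If_finite_set finK)
  ultimately have "(\<lambda>k. x ^ k / real k - (if k \<in> K then x ^ k / real k else 0)) sums (- ln (1 - x) - t)"
    by (rule sums_diff)
  also have "(\<lambda>k. x ^ k / real k - (if k \<in> K then x ^ k / real k else 0)) =
      (\<lambda>k. if k \<in> K then 0 else x ^ k / real k)" by auto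
  finally have diff: "(\<lambda>k. if k \<in> K then 0 else x ^ k / real k) sums (- ln (1 - x) - t)" .
  from sums_le[OF _ sums_zero diff] x have "0 \<le> - ln (1 - x) - t" by simp
  then show "t \<le> - ln (1 - real p powr -s)" by (simp add: x_def)
  have geo: "(\<lambda>k. real N powr (-1/4) * (if k \<in> {..<2} then 0 else y ^ k)) sums
      (real N powr (-1/4) * (y\<^sup>2 / (1 - y)))"
  proof (intro sums_mult)
    have "(\<lambda>k. y ^ 2 * y ^ k) sums (y ^ 2 * (1 / (1 - y)))"
      using y by (intro sums_mult geometric_sums) auto
    then have "(\<lambda>k. (if k + 2 \<in> {..<2} then 0 else y ^ (k + 2))) sums (y\<^sup>2 / (1 - y))"
      by (simp add: power2_eq_square mult_ac)
    then show "(\<lambda>k. (if k \<in> {..<2} then 0 else y ^ k)) sums (y\<^sup>2 / (1 - y))"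
      by (subst (asm) sums_iff_shift) (simp add: numeral_2_eq_2)
  qed
  have "- ln (1 - x) - t \<le> real N powr (-1/4) * (y\<^sup>2 / (1 - y))"
  proof (rule sums_le[OF _ diff geo])
    fix k
    show "(if k \<in> K then 0 else x ^ k / real k) \<le> real N powr (-1/4) * (if k \<in> {..<2} then 0 else y ^ k)"
    proof (cases "k \<in> K \<or> k = 0")
      case True
      then show ?thesis using y by auto
    next
      case False
      then have k: "k > 0" "p ^ k > N" by (auto simp: K_def)
      then have k2: "k \<ge> 2" using p by (cases "k = 1") auto
      have "x ^ k / real k \<le> x ^ k" using k x by (simp add: divide_le_eq)
      also have "\<dots> \<le> (real p powr -1) ^ k"
        unfolding x_def using p2 s by (intro power_mono powr_mono) auto
      also \<comment> \<open>a quarter of the exponent is spent on \<open>N\<close>; the rest stays summable over \<open>p\<close> as \<open>k \<ge> 2\<close>\<close>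
      have "\<dots> = (real (p ^ k)) powr (-1/4) * y ^ k"
        using p2 by (simp add: y_def powr_power powr_realpow [symmetric] powr_powr powr_add [symmetric] field_simps)
      also have "\<dots> \<le> real N powr (-1/4) * y ^ k"
        using k N y by (intro mult_right_mono powr_mono2') (auto simp del: of_nat_power)
      finally show ?thesis using k2 False by simp
    qed
  qed
  \<comment> \<open>The denominator is replaced by its smallest value, attained at
    \<open>p = 2\<close>, to make it independent of \<open>p\<close>.\<close>
  also have "\<dots> \<le> real N powr (-1/4) * (y\<^sup>2 / (1 - 2 powr (-3/4)))"
    using y by (intro mult_left_mono divide_left_mono mult_pos_pos) (auto simp: powr_less_one)
  also have "y\<^sup>2 = real p powr (-3/2)" using powr_power[of "real p" "-3/4" 2] p2 by (simp add: y_def)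
  finally show "- ln (1 - real p powr -s) \<le>
           t + real N powr (-1/4) * (real p powr (-3/2) / (1 - 2 powr (-3/4)))"
    by (simp add: x_def)
qed

lemma mangoldt_sum_powr_le_log_euler: "s \<ge> 1 \<Longrightarrow> mangoldt_sum_powr N s \<le> log_euler N s"
  unfolding mangoldt_sum_powr_altdef log_euler_def by (intro sum_mono log_euler_factor_tail) auto

text \<open>The factor tails add up because \<open>p powr (-3/2)\<close> is summable. As
  \<open>C\<close> depends on neither \<open>N\<close> nor \<open>s\<close>, the bound serves both
  for \<open>s > 1\<close> and at \<open>s = 1\<close>.\<close>

lemma log_euler_le_mangoldt_sum_powr:
  "\<exists>C. \<forall>N s. s \<ge> 1 \<longrightarrow> log_euler N s \<le> mangoldt_sum_powr N s + C * real N powr (-1/4)"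
proof -
  define c where "c = 1 / (1 - 2 powr (-3/4) :: real)"
  have c: "c > 0" by (auto simp: c_def powr_less_one)
  have summable: "summable (\<lambda>n. real n powr (-3/2))"
    by (simp add: summable_real_powr_iff)
  define S where "S = (\<Sum>n. real n powr (-3/2))"
  have "log_euler N s \<le> mangoldt_sum_powr N s + (c * S) * real N powr (-1/4)" if "s \<ge> 1" for N s
  proof -
    have "log_euler N s \<le> (\<Sum>p | prime p \<and> p \<le> N.
        (\<Sum>k | k > 0 \<and> p ^ k \<le> N. (real p powr -s) ^ k / real k) +
        real N powr (-1/4) * (real p powr (-3/2) / (1 - 2 powr (-3/4))))"
      unfolding log_euler_def using that by (intro sum_mono log_euler_factor_tail) auto
    also have "\<dots> = mangoldt_sum_powr N s +
        c * real N powr (-1/4) * (\<Sum>p | prime p \<and> p \<le> N. real p powr (-3/2))"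
      by (simp add: mangoldt_sum_powr_altdef sum.distrib sum_distrib_left c_def)
    also have "c * real N powr (-1/4) * (\<Sum>p | prime p \<and> p \<le> N. real p powr (-3/2)) \<le>
        c * real N powr (-1/4) * S"
      unfolding S_def using c by (intro mult_left_mono sum_le_suminf summable) auto
    finally show ?thesis by (simp add: mult_ac)
  qed
  then show ?thesis by blast
qed

section \<open>Mertens' third theorem\<close>

text \<open>The logarithm series with its index shifted, hence the division by \<open>r\<close>. It
  is the harmonic counterpart of the block series.\<close>

lemma sums_power_over_Suc:
  fixes r :: real
  assumes "0 < r" "r < 1"
  shows "(\<lambda>i. 1 / real (Suc i) * r ^ i) sums (- ln (1 - r) / r)"
proof -
  from sums_minus[OF Complex_Transcendental.ln_series'[of "-r"]]
  have "(\<lambda>k. r ^ k / real k) sums - ln (1 - r)" using assms by simp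
  then have "(\<lambda>k. r ^ Suc k / real (Suc k)) sums - ln (1 - r)"
    by (subst sums_Suc_iff) simp
  from sums_divide[OF this, of r] show ?thesis
    using assms by simp
qed

text \<open>
  Cutting the weights into the blocks \<open>exp i < n \<le> exp (i + 1)\<close> turns the Dirichlet series into a
  power series in \<open>exp (-\<delta>)\<close>, up to a factor of \<open>exp \<delta>\<close> that is harmless because the series
  itself only grows like \<open>ln (1 / \<delta>)\<close>.
\<close>

definition exp_floor :: "nat \<Rightarrow> nat" where
  "exp_floor i = nat \<lfloor>exp (real i)\<rfloor>"

definition block_weight :: "nat \<Rightarrow> real" where
  "block_weight i = (\<Sum>n\<in>{exp_floor i<..exp_floor (Suc i)}. mangoldt_weight n)"

lemma exp_floor_0 [simp]: "exp_floor 0 = 1"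
  by (simp add: exp_floor_def)

lemma exp_floor_mono: "i \<le> j \<Longrightarrow> exp_floor i \<le> exp_floor j"
  unfolding exp_floor_def by (intro nat_mono floor_mono) auto

lemma exp_floor_pos: "exp_floor i > 0"
  using exp_floor_mono[of 0 i] by simp

lemma exp_floor_bounds: "real (exp_floor i) \<le> exp (real i)" "exp (real i) < real (exp_floor i) + 1"
  unfolding exp_floor_def by simp_all

lemma exp_floor_at_top: "filterlim exp_floor at_top sequentially"
proof -
  have "filterlim (\<lambda>i. real (exp_floor i)) at_top sequentially"
  proof (rule filterlim_at_top_mono)
    show "filterlim (\<lambda>i. exp (real i) - 1) at_top sequentially" by real_asymp
    show "\<forall>\<^sub>F i in sequentially. exp (real i) - 1 \<le> real (exp_floor i)"
      using exp_floor_bounds(2) by (intro always_eventually allI) (simp add: less_imp_le algebra_simps)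
  qed
  then show ?thesis by (simp add: filterlim_sequentially_iff_filterlim_real)
qed

text \<open>Squeezed by \<open>exp M - 1 \<le> exp_floor M \<le> exp M\<close>.\<close>

lemma ln_ln_exp_floor: "(\<lambda>M. ln (ln (real (exp_floor M))) - ln (real M)) \<longlonglongrightarrow> 0"
proof (rule tendsto_sandwich)
  show "(\<lambda>M. ln (ln (exp (real M) - 1)) - ln (real M)) \<longlonglongrightarrow> 0" by real_asymp
  have "\<forall>\<^sub>F M in sequentially. ln (ln (exp (real M) - 1)) \<le> ln (ln (real (exp_floor M))) \<and>
          ln (ln (real (exp_floor M))) \<le> ln (real M)"
    \<comment> \<open>From 2 on, \<open>exp M - 1\<close> exceeds 1, so its logarithm is positive
      and the outer logarithm is monotone there.\<close>
    using eventually_ge_at_top[of 2]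
  proof eventually_elim
    case (elim M)
    have "exp (real M) \<ge> 1 + real M" by (rule exp_ge_add_one_self)
    then have *: "exp (real M) - 1 > 1" "exp (real M) - 1 \<le> real (exp_floor M)"
      using exp_floor_bounds[of M] elim by linarith+
    then have "ln (real (exp_floor M)) \<le> ln (exp (real M))"
      using exp_floor_bounds[of M] by (intro ln_mono) auto
    with * elim show ?case by (intro conjI ln_mono) (auto intro!: ln_gt_zero)
  qed
  then show "\<forall>\<^sub>F M in sequentially. ln (ln (exp (real M) - 1)) - ln (real M) \<le> ln (ln (real (exp_floor M))) - ln (real M)"
    "\<forall>\<^sub>F M in sequentially. ln (ln (real (exp_floor M))) - ln (real M) \<le> 0"
    by (auto elim!: eventually_mono)
qed auto

text \<open>The blocks start above \<open>exp_floor 0 = 1\<close>, hence the correction by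
  \<open>g 1\<close>, which vanishes for the weights used.\<close>

lemma sum_blocks:
  fixes g :: "nat \<Rightarrow> real"
  shows "(\<Sum>i<M. \<Sum>n\<in>{exp_floor i<..exp_floor (Suc i)}. g n) = (\<Sum>n=1..exp_floor M. g n) - g 1"
proof (induction M)
  case (Suc M)
  have "{1..exp_floor (Suc M)} = {1..exp_floor M} \<union> {exp_floor M<..exp_floor (Suc M)}"
    using exp_floor_mono[of M "Suc M"] exp_floor_pos[of M] by auto
  then have "(\<Sum>n=1..exp_floor (Suc M). g n) =
      (\<Sum>n=1..exp_floor M. g n) + (\<Sum>n\<in>{exp_floor M<..exp_floor (Suc M)}. g n)"
    by (simp only:) (subst sum.union_disjoint, auto)
  with Suc show ?case by simp
qed auto

lemma block_weight_nonneg: "block_weight i \<ge> 0"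
  unfolding block_weight_def by (intro sum_nonneg mangoldt_weight_nonneg)

text \<open>On block \<open>i\<close> the factor \<open>n powr -\<delta>\<close> lies between the
  powers \<open>i + 1\<close> and \<open>i\<close> of \<open>exp (-\<delta>)\<close>.\<close>

lemma block_sum_bounds:
  fixes \<delta> :: real
  assumes "\<delta> > 0"
  shows "(\<Sum>i<M. block_weight i * exp (-\<delta>) ^ Suc i) \<le> mangoldt_sum_powr (exp_floor M) (1 + \<delta>)"
    and "mangoldt_sum_powr (exp_floor M) (1 + \<delta>) \<le> (\<Sum>i<M. block_weight i * exp (-\<delta>) ^ i)"
proof -
  have eq: "mangoldt_sum_powr (exp_floor M) (1 + \<delta>) =
      (\<Sum>i<M. \<Sum>n\<in>{exp_floor i<..exp_floor (Suc i)}. mangoldt_weight n * real n powr -\<delta>)"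
    unfolding sum_blocks mangoldt_sum_powr_def by simp
  have powr_exp: "exp (real i) powr -\<delta> = exp (-\<delta>) ^ i" for i
    by (simp add: powr_def exp_of_nat_mult [symmetric] mult.commute)
  have "exp (-\<delta>) ^ Suc i \<le> real n powr -\<delta> \<and> real n powr -\<delta> \<le> exp (-\<delta>) ^ i"
    if "n \<in> {exp_floor i<..exp_floor (Suc i)}" for n i
  proof -
    have "exp (real i) \<le> real n" "real n \<le> exp (real (Suc i))"
      using that exp_floor_bounds(2)[of i] exp_floor_bounds(1)[of "Suc i"] by auto
    moreover have "n > 0" using that by auto
    ultimately show ?thesis
      unfolding powr_exp [symmetric] using assms by (auto intro!: powr_mono2')
  qed
  then show "(\<Sum>i<M. block_weight i * exp (-\<delta>) ^ Suc i) \<le> mangoldt_sum_powr (exp_floor M) (1 + \<delta>)"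
    and "mangoldt_sum_powr (exp_floor M) (1 + \<delta>) \<le> (\<Sum>i<M. block_weight i * exp (-\<delta>) ^ i)"
    unfolding eq block_weight_def sum_distrib_right
    by (intro sum_mono mult_left_mono mangoldt_weight_nonneg; blast)+
qed

text \<open>From above, the Euler product bounds all partial sums, at the cost of one factor
  \<open>r\<close>. From below, \<delta> is fixed while the truncation point grows, so the errors
  \<open>N powr (-1/4)\<close> and \<open>(N + 1) powr -\<delta>\<close> disappear.\<close>

lemma block_series_bounds:
  fixes \<delta> :: real
  assumes \<delta>: "\<delta> > 0"
  defines "r \<equiv> exp (-\<delta>)"
  shows "summable (\<lambda>i. block_weight i * r ^ i)"
    and "(\<Sum>i. block_weight i * r ^ i) \<le> ln (1 + 1 / \<delta>) / r"
    and "ln (1 / \<delta>) \<le> (\<Sum>i. block_weight i * r ^ i)"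
proof -
  have r: "r > 0" by (simp add: r_def)
  have partial: "(\<Sum>i<M. block_weight i * r ^ i) \<le> ln (1 + 1 / \<delta>) / r" for M
  proof -
    have "r * (\<Sum>i<M. block_weight i * r ^ i) = (\<Sum>i<M. block_weight i * r ^ Suc i)"
      by (simp add: sum_distrib_left mult_ac)
    also have "\<dots> \<le> mangoldt_sum_powr (exp_floor M) (1 + \<delta>)"
      unfolding r_def by (rule block_sum_bounds) fact
    also have "\<dots> \<le> log_euler (exp_floor M) (1 + \<delta>)"
      using \<delta> by (intro mangoldt_sum_powr_le_log_euler) auto
    also have "\<dots> \<le> ln (1 + 1 / \<delta>)"
      by (intro log_euler_bounds \<delta> exp_floor_pos)
    finally show ?thesis using r by (simp add: field_simps)
  qed
  have nonneg: "block_weight i * r ^ i \<ge> 0" for i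
    using r block_weight_nonneg by simp
  show summable: "summable (\<lambda>i. block_weight i * r ^ i)"
    by (rule summableI_nonneg_bounded[OF nonneg partial])
  show "(\<Sum>i. block_weight i * r ^ i) \<le> ln (1 + 1 / \<delta>) / r"
    by (rule suminf_le_const[OF summable partial])
  obtain C where C: "\<And>N s. s \<ge> 1 \<Longrightarrow> log_euler N s \<le> mangoldt_sum_powr N s + C * real N powr (-1/4)"
    using log_euler_le_mangoldt_sum_powr by blast
  define lower where "lower = (\<lambda>N. ln ((1 - real (Suc N) powr -\<delta>) / \<delta>) - C * real N powr (-1/4))"
  have "lower (exp_floor M) \<le> (\<Sum>i. block_weight i * r ^ i)" for M
  proof -
    have "lower (exp_floor M) \<le> mangoldt_sum_powr (exp_floor M) (1 + \<delta>)"
      using C[of "1 + \<delta>" "exp_floor M"] log_euler_bounds(2)[OF \<delta> exp_floor_pos[of M]] \<delta>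
      by (simp add: lower_def)
    also have "\<dots> \<le> (\<Sum>i<M. block_weight i * r ^ i)"
      unfolding r_def by (rule block_sum_bounds) fact
    also have "\<dots> \<le> (\<Sum>i. block_weight i * r ^ i)"
      by (intro sum_le_suminf summable nonneg) auto
    finally show ?thesis .
  qed
  moreover have "(\<lambda>M. lower (exp_floor M)) \<longlonglongrightarrow> ln (1 / \<delta>)"
  proof (rule filterlim_compose[OF _ exp_floor_at_top])
    have "(\<lambda>N. real (Suc N) powr -\<delta>) \<longlonglongrightarrow> 0" using \<delta> by real_asymp
    moreover have "(\<lambda>N. C * real N powr (-1/4)) \<longlonglongrightarrow> 0" by real_asymp
    ultimately have "lower \<longlonglongrightarrow> ln ((1 - 0) / \<delta>) - 0"
      unfolding lower_def using \<delta> by (intro tendsto_intros) auto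
    then show "lower \<longlonglongrightarrow> ln (1 / \<delta>)" by simp
  qed
  ultimately show "ln (1 / \<delta>) \<le> (\<Sum>i. block_weight i * r ^ i)"
    by (intro LIMSEQ_le_const2) auto
qed

text \<open>Convergence is already known, so Abel's theorem can compute the limit and no Tauberian
  argument is needed. Since prime powers are counted as well, the constant is Euler's.\<close>

lemma mertens_second:
  "(\<lambda>N. (\<Sum>n=1..N. mangoldt_weight n) - ln (ln (real N))) \<longlonglongrightarrow> euler_mascheroni"
proof -
  obtain C where C: "(\<lambda>N. (\<Sum>n=1..N. mangoldt_weight n) - ln (ln (real N))) \<longlonglongrightarrow> C"
    using convergent_sum_mangoldt_weight by (auto simp: convergent_def)
  define d where "d = (\<lambda>i. block_weight i - 1 / real (Suc i))"
  \<comment> \<open>Along \<open>exp_floor M\<close> the iterated logarithm is close to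
    \<open>ln M\<close>, hence to the harmonic number up to Euler's constant. The expression is
    arranged to collapse to the partial sums of \<open>d\<close>.\<close>
  have "(\<lambda>M. ((\<Sum>n=1..exp_floor M. mangoldt_weight n) - ln (ln (real (exp_floor M))))
          + (ln (ln (real (exp_floor M))) - ln (real M)) - (harm M - ln (real M)))
        \<longlonglongrightarrow> C + 0 - euler_mascheroni"
    by (intro tendsto_intros filterlim_compose[OF C exp_floor_at_top] ln_ln_exp_floor euler_mascheroni_LIMSEQ)
  moreover have "((\<Sum>n=1..exp_floor M. mangoldt_weight n) - ln (ln (real (exp_floor M))))
          + (ln (ln (real (exp_floor M))) - ln (real M)) - (harm M - ln (real M)) = (\<Sum>i<M. d i)" for M
  proof -
    have "(\<Sum>i<M. d i) = (\<Sum>i<M. block_weight i) - (\<Sum>i<M. 1 / real (Suc i))"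
      by (simp add: d_def sum_subtractf)
    also have "(\<Sum>i<M. block_weight i) = (\<Sum>n=1..exp_floor M. mangoldt_weight n)"
      unfolding block_weight_def sum_blocks by simp
    also have "(\<Sum>i<M. 1 / real (Suc i)) = harm M"
      by (induction M) (auto simp: harm_Suc harm_expand inverse_eq_divide)
    finally show ?thesis by simp
  qed
  ultimately have "d sums (C - euler_mascheroni)"
    by (simp add: sums_def)
  then have abel: "((\<lambda>r. \<Sum>i. d i * r ^ i) \<longlongrightarrow> C - euler_mascheroni) (at_left 1)"
    by (rule abel_limit_theorem)
  have "filterlim (\<lambda>\<delta>::real. exp (-\<delta>)) (at_left 1) (at_right 0)"
    by real_asymp
  from filterlim_compose[OF abel this]
  have lim: "((\<lambda>\<delta>. \<Sum>i. d i * exp (-\<delta>) ^ i) \<longlongrightarrow> C - euler_mascheroni) (at_right 0)" .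
  have bounds: "ln (1 / \<delta>) + ln (1 - exp (-\<delta>)) / exp (-\<delta>) \<le> (\<Sum>i. d i * exp (-\<delta>) ^ i)"
       "(\<Sum>i. d i * exp (-\<delta>) ^ i) \<le> ln (1 + 1 / \<delta>) / exp (-\<delta>) + ln (1 - exp (-\<delta>)) / exp (-\<delta>)"
    if \<delta>: "\<delta> > 0" for \<delta> :: real
  proof -
    have "(\<lambda>i. block_weight i * exp (-\<delta>) ^ i - 1 / real (Suc i) * exp (-\<delta>) ^ i) sums
        ((\<Sum>i. block_weight i * exp (-\<delta>) ^ i) - (- ln (1 - exp (-\<delta>)) / exp (-\<delta>)))"
      using \<delta> by (intro sums_diff summable_sums block_series_bounds sums_power_over_Suc) auto
    then have "(\<Sum>i. d i * exp (-\<delta>) ^ i) =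
        (\<Sum>i. block_weight i * exp (-\<delta>) ^ i) + ln (1 - exp (-\<delta>)) / exp (-\<delta>)"
      by (simp add: sums_iff d_def left_diff_distrib)
    then show "ln (1 / \<delta>) + ln (1 - exp (-\<delta>)) / exp (-\<delta>) \<le> (\<Sum>i. d i * exp (-\<delta>) ^ i)"
       "(\<Sum>i. d i * exp (-\<delta>) ^ i) \<le> ln (1 + 1 / \<delta>) / exp (-\<delta>) + ln (1 - exp (-\<delta>)) / exp (-\<delta>)"
      using block_series_bounds(2,3)[OF \<delta>] by linarith+
  qed
  \<comment> \<open>\<open>ln (1 - exp (-\<delta>))\<close> is \<open>ln \<delta>\<close> up to o(1)
    and cancels \<open>ln (1 / \<delta>)\<close>; dividing by \<open>exp (-\<delta>)\<close> changes
    each logarithm only by order \<open>\<delta> * ln (1 / \<delta>)\<close>.\<close>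
  have "((\<lambda>\<delta>. \<Sum>i. d i * exp (-\<delta>) ^ i) \<longlongrightarrow> 0) (at_right 0)"
  proof (rule tendsto_sandwich)
    show "((\<lambda>\<delta>::real. ln (1 / \<delta>) + ln (1 - exp (-\<delta>)) / exp (-\<delta>)) \<longlongrightarrow> 0) (at_right 0)"
      by real_asymp
    show "((\<lambda>\<delta>::real. ln (1 + 1 / \<delta>) / exp (-\<delta>) + ln (1 - exp (-\<delta>)) / exp (-\<delta>)) \<longlongrightarrow> 0) (at_right 0)"
      by real_asymp
  qed (auto intro!: eventually_at_rightI[of 0 1] bounds)
  from tendsto_unique[OF _ lim this] have "C = euler_mascheroni" by simp
  with C show ?thesis by simp
qed

text \<open>At \<open>s = 1\<close> the logarithm of the Euler product exceeds the sum in
  \<open>mertens_second\<close> by at most a multiple of \<open>N powr (-1/4)\<close>;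
  exponentiate.\<close>

lemma mertens_third:
  "(\<lambda>N. (\<Prod>p | prime p \<and> p \<le> N. real p / (real p - 1)) / ln (real N)) \<longlonglongrightarrow> exp euler_mascheroni"
proof -
  obtain C where C: "\<And>N s. s \<ge> 1 \<Longrightarrow> log_euler N s \<le> mangoldt_sum_powr N s + C * real N powr (-1/4)"
    using log_euler_le_mangoldt_sum_powr by blast
  have eq: "mangoldt_sum_powr N 1 = (\<Sum>n=1..N. mangoldt_weight n)" for N
    unfolding mangoldt_sum_powr_def by (intro sum.cong) auto
  have "(\<lambda>N. log_euler N 1 - ln (ln (real N))) \<longlonglongrightarrow> euler_mascheroni"
  proof (rule tendsto_sandwich[OF _ _ mertens_second])
    have "(\<lambda>N. (\<Sum>n=1..N. mangoldt_weight n) - ln (ln (real N)) + C * real N powr (-1/4))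
        \<longlonglongrightarrow> euler_mascheroni + 0"
      by (intro tendsto_add mertens_second) real_asymp
    then show "(\<lambda>N. (\<Sum>n=1..N. mangoldt_weight n) - ln (ln (real N)) + C * real N powr (-1/4))
        \<longlonglongrightarrow> euler_mascheroni" by simp
    show "\<forall>\<^sub>F N in sequentially. (\<Sum>n=1..N. mangoldt_weight n) - ln (ln (real N)) \<le> log_euler N 1 - ln (ln (real N))"
      using mangoldt_sum_powr_le_log_euler[of 1] by (auto simp: eq)
    show "\<forall>\<^sub>F N in sequentially. log_euler N 1 - ln (ln (real N)) \<le>
        (\<Sum>n=1..N. mangoldt_weight n) - ln (ln (real N)) + C * real N powr (-1/4)"
      using C[of 1] by (auto simp: eq algebra_simps)
  qed
  then have "(\<lambda>N. exp (log_euler N 1 - ln (ln (real N)))) \<longlonglongrightarrow> exp euler_mascheroni"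
    by (rule tendsto_exp)
  moreover have "\<forall>\<^sub>F N in sequentially. exp (log_euler N 1 - ln (ln (real N))) =
      (\<Prod>p | prime p \<and> p \<le> N. real p / (real p - 1)) / ln (real N)"
    \<comment> \<open>Beyond 1, \<open>ln N\<close> is positive, so \<open>exp\<close> undoes the
      outer logarithm.\<close>
    using eventually_gt_at_top[of 1]
  proof eventually_elim
    case (elim N)
    have "1 / (1 - real p powr - 1) = real p / (real p - 1)" if "prime p" for p
      using prime_gt_1_nat[OF that] by (simp add: powr_minus field_simps)
    with elim show ?case
      by (simp add: exp_diff exp_log_euler)
  qed
  ultimately show ?thesis by (simp add: tendsto_cong)
qed

section \<open>Interpolation between consecutive primes\<close>

text \<open>\<open>1 \<le> m\<close> matters: truncated subtraction makes \<open>nth_prime 0\<close>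
  equal to \<open>nth_prime 1\<close>.\<close>

lemma nth_prime_less: "1 \<le> m \<Longrightarrow> m < n \<Longrightarrow> nth_prime m < nth_prime n"
  unfolding nth_prime_def by (intro enumerate_mono primes_infinite) auto

lemma nth_prime_inj_on: "inj_on nth_prime {1..n}"
proof (rule linorder_inj_onI)
  show "nth_prime x \<noteq> nth_prime y" if "x < y" "x \<in> {1..n}" for x y
    using nth_prime_less[of x y] that by auto
qed auto

lemma primes_le_nth_prime:
  assumes "n \<ge> 1"
  shows "{p. prime p \<and> p \<le> nth_prime n} = nth_prime ` {1..n}"
proof (intro equalityI subsetI)
  fix p assume p: "p \<in> {p. prime p \<and> p \<le> nth_prime n}"
  then obtain k where k: "p = enumerate {p. prime p} k"
    using enumerate_Ex[of "{p. prime p}" p] primes_infinite by auto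
  then have eq: "p = nth_prime (Suc k)" by (simp add: nth_prime_def)
  have "Suc k \<le> n"
    using p nth_prime_less[of n "Suc k"] assms unfolding eq by (auto intro: leI)
  then show "p \<in> nth_prime ` {1..n}" using eq by auto
next
  fix p assume "p \<in> nth_prime ` {1..n}"
  then obtain k where k: "1 \<le> k" "k \<le> n" "p = nth_prime k" by auto
  then show "p \<in> {p. prime p \<and> p \<le> nth_prime n}"
    using nth_prime_less[of k n] by (cases "k = n") (auto simp: prime_nth_prime)
qed

lemma filterlim_nth_prime: "filterlim nth_prime at_top sequentially"
proof -
  have "n \<le> nth_prime n" for n
  proof (induction n)
    case (Suc n)
    then show ?case
      using nth_prime_less[of n "Suc n"] nth_prime_1 by (cases "n = 0") auto
  qed simp
  then show ?thesis
    by (intro filterlim_at_top_mono[OF filterlim_ident]) auto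
qed

text \<open>\<open>f_prod\<close> as a function of the index, so that limits of sequences can be
  composed with \<open>n_idx\<close>.\<close>

definition euler_factor_prod :: "nat \<Rightarrow> real" where
  "euler_factor_prod n = (\<Prod>i=1..n. real (nth_prime i) / (real (nth_prime i) - 1))"

lemma euler_factor_prod_pos: "euler_factor_prod n > 0"
  unfolding euler_factor_prod_def
  using prime_gt_1_nat[OF prime_nth_prime] by (intro prod_pos) (auto intro!: divide_pos_pos simp: prime_gt_0_nat prime_nth_prime)

text \<open>Mertens' third theorem along the subsequence of primes, with the product reindexed by
  \<open>primes_le_nth_prime\<close>.\<close>

lemma euler_factor_prod_lower_prime:
  "(\<lambda>n. euler_factor_prod n / (exp euler_mascheroni * ln (real (nth_prime n)))) \<longlonglongrightarrow> 1"
proof -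
  have "(\<lambda>n. (\<Prod>p | prime p \<and> p \<le> nth_prime n. real p / (real p - 1)) / ln (real (nth_prime n)) /
      exp euler_mascheroni) \<longlonglongrightarrow> exp euler_mascheroni / exp euler_mascheroni"
    by (intro tendsto_divide tendsto_const filterlim_compose[OF mertens_third filterlim_nth_prime]) auto
  moreover have "\<forall>\<^sub>F n in sequentially. (\<Prod>p | prime p \<and> p \<le> nth_prime n. real p / (real p - 1)) /
      ln (real (nth_prime n)) / exp euler_mascheroni =
      euler_factor_prod n / (exp euler_mascheroni * ln (real (nth_prime n)))"
    using eventually_ge_at_top[of 1]
    by eventually_elim
       (simp add: primes_le_nth_prime prod.reindex[OF nth_prime_inj_on, simplified] euler_factor_prod_def mult.commute)
  ultimately show ?thesis by (simp add: tendsto_cong)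
qed

text \<open>The product changes only by the factor \<open>1 - 1 / p\<close> with \<open>p = nth_prime (Suc n)\<close>, so no bound on
  prime gaps is needed.\<close>
lemma euler_factor_prod_upper_prime:
  "(\<lambda>n. euler_factor_prod n / (exp euler_mascheroni * ln (real (nth_prime (Suc n))))) \<longlonglongrightarrow> 1"
proof -
  have "filterlim (\<lambda>n. real (nth_prime (Suc n))) at_top sequentially"
    by (intro filterlim_compose[OF filterlim_real_sequentially]
        filterlim_compose[OF filterlim_nth_prime filterlim_Suc])
  then have "(\<lambda>n. 1 / real (nth_prime (Suc n))) \<longlonglongrightarrow> 0"
    by (intro tendsto_divide_0[OF tendsto_const] filterlim_at_top_imp_at_infinity)
  then have "(\<lambda>n. euler_factor_prod (Suc n) / (exp euler_mascheroni * ln (real (nth_prime (Suc n)))) *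
      (1 - 1 / real (nth_prime (Suc n)))) \<longlonglongrightarrow> 1 * (1 - 0)"
    by (intro tendsto_intros filterlim_compose[OF euler_factor_prod_lower_prime filterlim_Suc])
  moreover have "euler_factor_prod (Suc n) * (1 - 1 / real (nth_prime (Suc n))) = euler_factor_prod n" for n
    using prime_gt_1_nat[OF prime_nth_prime[of "Suc n"]]
    by (simp add: euler_factor_prod_def field_simps)
  ultimately show ?thesis by simp
qed

section \<open>The index function and the final squeeze\<close>

lemma n_idx_props:
  assumes "x \<ge> 2"
  shows "n_idx x \<ge> 1" "real (primorial (n_idx x)) \<le> x" "x < real (primorial (n_idx x + 1))"
  using theI'[OF ex1_primorial_index[OF assms]] unfolding n_idx_def by auto

lemma filterlim_n_idx: "filterlim n_idx at_top at_top"
proof (rule filterlim_at_top[THEN iffD2], rule allI)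
  fix M :: nat
  show "\<forall>\<^sub>F x in at_top. M \<le> n_idx x"
    using eventually_ge_at_top[of 2] eventually_ge_at_top[of "real (primorial M)"]
  proof eventually_elim
    case (elim x)
    have "primorial M < primorial (n_idx x + 1)"
      using n_idx_props(3)[OF elim(1)] elim(2) by linarith
    then show ?case by (simp add: strict_mono_less[OF strict_mono_primorial])
  qed
qed

text \<open>Clearing the denominator exhibits \<open>y_interp x\<close> as
  \<open>p + (q - p) * r\<close>, a convex combination because \<open>r_frac x\<close> lies between
  0 and 1.\<close>

lemma y_interp_bounds:
  assumes "x \<ge> 2"
  shows "real (nth_prime (n_idx x)) \<le> y_interp x" "y_interp x \<le> real (nth_prime (Suc (n_idx x)))"
proof -
  define p q r where "p = real (nth_prime (n_idx x))" and "q = real (nth_prime (Suc (n_idx x)))"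
    and "r = r_frac x"
  note n = n_idx_props[OF assms]
  have "p > 0" by (simp add: p_def prime_gt_0_nat prime_nth_prime)
  then have y: "y_interp x = p + (q - p) * r"
    unfolding y_interp_def by (simp add: p_def q_def r_def field_simps)
  have "p \<le> q" using nth_prime_less[of "n_idx x" "Suc (n_idx x)"] n by (simp add: p_def q_def)
  moreover have r: "0 \<le> r" "r \<le> 1" using n by (auto simp: r_def r_frac_def)
  ultimately have "0 \<le> (q - p) * r" "(q - p) * r \<le> (q - p) * 1"
    using mult_left_mono[of r 1 "q - p"] by simp_all
  then show "real (nth_prime (n_idx x)) \<le> y_interp x" "y_interp x \<le> real (nth_prime (Suc (n_idx x)))"
    unfolding y p_def [symmetric] q_def [symmetric] by simp_all
qed

theorem theorem3p4:
  shows "((\<lambda>x::real. f_prod x / g_circ x) \<longlongrightarrow> 1) at_top"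
proof (rule tendsto_sandwich)
  let ?\<gamma> = "exp euler_mascheroni :: real"
  show "((\<lambda>x. euler_factor_prod (n_idx x) / (?\<gamma> * ln (real (nth_prime (Suc (n_idx x)))))) \<longlongrightarrow> 1) at_top"
    by (rule filterlim_compose[OF euler_factor_prod_upper_prime filterlim_n_idx])
  show "((\<lambda>x. euler_factor_prod (n_idx x) / (?\<gamma> * ln (real (nth_prime (n_idx x))))) \<longlongrightarrow> 1) at_top"
    by (rule filterlim_compose[OF euler_factor_prod_lower_prime filterlim_n_idx])
  \<comment> \<open>All logarithms involved are positive, so the larger prime gives the smaller
    quotient: the upper prime bounds from below, the lower prime from above.\<close>
  have "\<forall>\<^sub>F x in at_top.
      euler_factor_prod (n_idx x) / (?\<gamma> * ln (real (nth_prime (Suc (n_idx x))))) \<le> f_prod x / g_circ x \<and>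
      f_prod x / g_circ x \<le> euler_factor_prod (n_idx x) / (?\<gamma> * ln (real (nth_prime (n_idx x))))"
    using eventually_ge_at_top[of 2]
  proof eventually_elim
    case (elim x)
    note y = y_interp_bounds[OF elim]
    have p: "real (nth_prime (n_idx x)) > 1"
      using prime_gt_1_nat[OF prime_nth_prime] by simp
    have "0 < ln (real (nth_prime (n_idx x)))" "ln (real (nth_prime (n_idx x))) \<le> ln (y_interp x)"
      "ln (y_interp x) \<le> ln (real (nth_prime (Suc (n_idx x))))"
      using p y by auto
    moreover have "f_prod x = euler_factor_prod (n_idx x)"
      by (simp add: f_prod_def euler_factor_prod_def)
    ultimately show ?case
      unfolding g_circ_def using euler_factor_prod_pos[of "n_idx x"]
      by (auto intro!: divide_left_mono mult_left_mono mult_pos_pos)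
  qed
  then show "\<forall>\<^sub>F x in at_top.
      euler_factor_prod (n_idx x) / (?\<gamma> * ln (real (nth_prime (Suc (n_idx x))))) \<le> f_prod x / g_circ x"
    and "\<forall>\<^sub>F x in at_top.
      f_prod x / g_circ x \<le> euler_factor_prod (n_idx x) / (?\<gamma> * ln (real (nth_prime (n_idx x))))"
    by (auto elim: eventually_mono)
qed

end
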